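(* Let $\mathbb{F}_q$ be a finite field with $q$ elements and let $L$ be a non-abelian Lie algebra of finite dimension $n$ over $\mathbb{F}_q$ with $Z(L)=0$. Then $$d(L)\leq \frac{q^{n}+q-1}{q^{n+1}},$$ and equality holds if and only if $\dim L^{2}=1$.
   Context: For a finite-dimensional Lie algebra $L$ over the finite field $\mathbb{F}_q$ (so $L$ is a finite set), the commutativity degree of $L$ is $d(L)=\dfrac{|\{(x,y)\in L\times L \mid [x,y]=0\}|}{|L|^{2}}$. Here $Z(L)=\{z\in L\mid [z,x]=0 \text{ for all } x\in L\}$ is the center of $L$, and $L^{2}=[L,L]$ is the derived subalgebra, i.e. the linear span of all brackets $[x,y]$ with $x,y\in L$. *)

theory Defs
  imports Complex_Main
begin

locale lie_algebra = vector_space scale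
  for scale :: "'k::field \<Rightarrow> 'l::ab_group_add \<Rightarrow> 'l" (infixr \<open>*s\<close> 75) +
  fixes bracket :: "'l \<Rightarrow> 'l \<Rightarrow> 'l"
  assumes linear_bracket_left: "Vector_Spaces.linear (*s) (*s) (\<lambda>x. bracket x y)"
    and linear_bracket_right: "Vector_Spaces.linear (*s) (*s) (\<lambda>y. bracket x y)"
    and bracket_self: "bracket x x = 0"
    and jacobi: "bracket x (bracket y z) + bracket y (bracket z x) + bracket z (bracket x y) = 0"
begin

definition abelian :: bool where
  "abelian \<longleftrightarrow> (\<forall>x y. bracket x y = 0)"

definition center :: "'l set" where
  "center = {z. \<forall>x. bracket z x = 0}"

definition derived_subalgebra :: "'l set" where
  "derived_subalgebra = span {bracket x y | x y. True}"

text \<open>Meaningful when \<^typ>\<open>'l\<close> is a finite set, as for a finite-dimensional Lie algebra over a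
  finite field; otherwise the value is 0 by the convention for \<^const>\<open>card\<close>.\<close>

definition commutativity_degree :: real where
  "commutativity_degree =
     real (card {(x, y). bracket x y = 0}) / real (card (UNIV :: 'l set)) ^ 2"

end

text \<open>A finite basis is the parameter of the library's locale
  \<^locale>\<open>finite_dimensional_vector_space\<close>.\<close>

locale finite_dimensional_lie_algebra =
  lie_algebra scale bracket + finite_dimensional_vector_space scale Basis
  for scale :: "'k::field \<Rightarrow> 'l::ab_group_add \<Rightarrow> 'l" (infixr \<open>*s\<close> 75)
    and bracket :: "'l \<Rightarrow> 'l \<Rightarrow> 'l"
    and Basis :: "'l set"

end

theory Submission
  imports Defs
begin

text \<open>
  Counting commuting pairs by their first entry gives \<open>\<Sum>x. |ker (ad x)|\<close>. Since the center is
  trivial, \<open>ad x\<close> is nonzero for \<open>x \<noteq> 0\<close>, so its image has at least \<open>q\<close> elements and its kernel at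
  most \<open>q ^ (n - 1)\<close>; summation gives the bound, with equality if and only if the image of every
  \<open>ad x\<close> with \<open>x \<noteq> 0\<close> is a line. In that case all brackets lie on one line: if \<open>[a, b]\<close> and
  \<open>[c, d]\<close> were independent, then \<open>[a, d]\<close> and \<open>[c, b]\<close> would each lie on both of the
  lines they span and hence vanish, so the image of \<open>ad (a + c)\<close> would contain both
  \<open>[a, b]\<close> and \<open>[c, d]\<close>.
\<close>

text \<open>The nonempty fibres of an additive map are translates of its kernel, so they partition
  the domain into equally large pieces. For \<open>bracket x\<close> this trades the size of the
  centralizer of \<open>x\<close> for the size of the image of ad x.\<close>

lemma card_kernel_mult_card_range:
  fixes f :: "'a::ab_group_add \<Rightarrow> 'b::ab_group_add"
  assumes add: "\<And>x y. f (x + y) = f x + f y" and fin: "finite (UNIV :: 'a set)"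
  shows "card {x. f x = 0} * card (range f) = card (UNIV :: 'a set)"
proof -
  have fibre: "card {x. f x = v} = card {x. f x = 0}" if v_range: "v \<in> range f" for v
  proof -
    obtain a where v: "v = f a" using v_range by blast
    have "{x. f x = v} = (+) a ` {x. f x = 0}"
    proof safe
      fix x assume "v = f x"
      then have "f (x - a) = 0"
        using add[of "x - a" a] v by simp
      then show "x \<in> (+) a ` {x. f x = 0}"
        by (intro image_eqI[of _ _ "x - a"]) auto
    qed (simp add: add v)
    then show ?thesis by (simp add: card_image)
  qed
  have "card (UNIV :: 'a set) = card (\<Union>v\<in>range f. {x. f x = v})"
    by (rule arg_cong[of _ _ card]) auto
  also have "\<dots> = (\<Sum>v\<in>range f. card {x. f x = v})"
    by (rule card_UN_disjoint) (auto intro: finite_subset[OF _ fin] finite_imageI[OF fin])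
  also have "\<dots> = card {x. f x = 0} * card (range f)"
    using fibre by simp
  finally show ?thesis by simp
qed

section \<open>Counting in vector spaces over a finite field\<close>

context vector_space
begin

lemma finite_card_span:
  assumes "finite (UNIV :: 'a set)" "finite B" "independent B"
  shows "finite (span B) \<and> card (span B) = card (UNIV :: 'a set) ^ card B"
  using assms(2,3)
proof (induction B rule: finite_induct)
  case empty
  then show ?case by simp
next
  case (insert b B)
  have indep: "independent B" and notin: "b \<notin> span B"
    using insert by (auto simp: independent_insert)
  have fin: "finite (span B)" and card: "card (span B) = card (UNIV :: 'a set) ^ card B"
    using insert.IH[OF indep] by auto
  define h where "h = (\<lambda>(k :: 'a, v). k *s b + v)"
  have "inj_on h (UNIV \<times> span B)"
  proof (rule inj_onI, clarify)
    fix k v l w assume v: "v \<in> span B" and w: "w \<in> span B" and eq: "h (k, v) = h (l, w)"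
    have diff: "(k - l) *s b = w - v"
      using eq by (simp add: h_def scale_left_diff_distrib algebra_simps)
    then have "(k - l) *s b \<in> span B"
      using v w by (simp add: span_diff)
    \<comment> \<open>Otherwise dividing by \<open>k - l\<close> would put \<open>b\<close> into
      \<open>span B\<close>.\<close>
    then have "k = l"
      using notin span_scale[of "(k - l) *s b" B "inverse (k - l)"] by (cases "k = l") simp_all
    then show "k = l \<and> v = w" using diff by simp
  qed
  moreover have "h ` (UNIV \<times> span B) = span (insert b B)"
  proof
    show "h ` (UNIV \<times> span B) \<subseteq> span (insert b B)"
    proof (clarsimp simp: h_def)
      fix k v assume "v \<in> span B"
      then have "v \<in> span (insert b B)" using span_mono[of B "insert b B"] by blast
      then show "k *s b + v \<in> span (insert b B)"
        by (simp add: span_add span_scale span_base)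
    qed
    show "span (insert b B) \<subseteq> h ` (UNIV \<times> span B)"
    proof
      fix x assume "x \<in> span (insert b B)"
      then obtain k where "x - k *s b \<in> span B" by (auto simp: span_insert)
      then show "x \<in> h ` (UNIV \<times> span B)"
        by (intro image_eqI[of _ _ "(k, x - k *s b)"]) (auto simp: h_def)
    qed
  qed
  ultimately have "bij_betw h (UNIV \<times> span B) (span (insert b B))"
    by (simp add: bij_betw_def)
  then show ?case
    using fin card assms(1) insert.hyps
    by (auto simp: bij_betw_same_card[symmetric] card_cartesian_product
        dest: bij_betw_finite)
qed

lemma mem_span_singleton_commute:
  assumes "x \<noteq> 0" "x \<in> span {y}"
  shows "y \<in> span {x}"
  using assms in_span_insert[of x y "{}"] by simp

end

context finite_dimensional_vector_space
begin

lemma card_subspace: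
  assumes "finite (UNIV :: 'a set)" "subspace S"
  shows "card S = card (UNIV :: 'a set) ^ dim S"
proof -
  obtain B where B: "B \<subseteq> S" "independent B" "S \<subseteq> span B" "card B = dim S"
    using basis_exists by blast
  have "span B = S" using B assms(2) by (simp add: span_subspace)
  then show ?thesis
    using finite_card_span[OF assms(1) finiteI_independent[OF B(2)] B(2)] B(4) by simp
qed

lemma finite_UNIV:
  assumes "finite (UNIV :: 'a set)"
  shows "finite (UNIV :: 'b set)"
  using finite_card_span[OF assms finite_Basis independent_Basis] by (simp add: span_Basis)

end

section \<open>Brackets and the lines they span\<close>

context lie_algebra
begin

lemma bracket_add_left: "bracket (x + y) z = bracket x z + bracket y z"
  and bracket_add_right: "bracket x (y + z) = bracket x y + bracket x z"
  and bracket_scale_right: "bracket x (k *s y) = k *s bracket x y"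
  using linear_bracket_left linear_bracket_right by (auto simp: Vector_Spaces.linear_iff)

lemma bracket_0_left [simp]: "bracket 0 y = 0"
  using bracket_add_left[of 0 0 y] by simp

lemma bracket_anticommute: "bracket y x = - bracket x y"
  using bracket_self[of "x + y"] bracket_self[of x] bracket_self[of y]
  by (simp add: bracket_add_left bracket_add_right eq_neg_iff_add_eq_0 add.commute)

text \<open>Source of the lower bound: once ad x is nonzero, its image contains a whole line, hence
  at least as many elements as there are scalars.\<close>

lemma span_singleton_subset_range_bracket: "span {bracket x y} \<subseteq> range (bracket x)"
proof
  fix v assume "v \<in> span {bracket x y}"
  then obtain k where "v = k *s bracket x y" by (auto simp: span_singleton)
  then show "v \<in> range (bracket x)" by (metis bracket_scale_right rangeI)
qed

lemma brackets_collinear: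
  assumes line: "\<And>x y z. bracket x y \<noteq> 0 \<Longrightarrow> bracket x z \<in> span {bracket x y}"
    and ab: "bracket a b \<noteq> 0"
  shows "bracket c d \<in> span {bracket a b}"
proof (rule ccontr)
  assume notin: "bracket c d \<notin> span {bracket a b}"
  then have cd: "bracket c d \<noteq> 0" by (metis span_zero)
  \<comment> \<open>Anticommutativity carries \<open>line\<close> over to the first
    argument.\<close>
  have line_left: "bracket z y \<in> span {bracket x y}" if "bracket x y \<noteq> 0" for x y z
  proof -
    have "bracket y z \<in> span {bracket y x}"
      using line[of y x z] that bracket_anticommute[of x y] by simp
    then obtain k where "bracket y z = k *s bracket y x" by (auto simp: span_singleton)
    then have "bracket z y = k *s bracket x y"
      using bracket_anticommute[of z y] bracket_anticommute[of x y] by simp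
    then show ?thesis by (auto simp: span_singleton)
  qed
  \<comment> \<open>A nonzero \<open>w\<close> on both lines would span each of them, putting
    \<open>bracket c d\<close> on the line of \<open>bracket a b\<close>.\<close>
  have both: "w = 0" if "w \<in> span {bracket a b}" "w \<in> span {bracket c d}" for w
    using that notin mem_span_singleton_commute[of w "bracket c d"]
    by (metis empty_subsetI insert_subset span_minimal subset_iff subspace_span)
  have ad: "bracket a d = 0" by (rule both[OF line[OF ab] line_left[OF cd]])
  have cb: "bracket c b = 0" by (rule both[OF line_left[OF ab] line[OF cd]])
  have "bracket (a + c) b = bracket a b" "bracket (a + c) d = bracket c d"
    using ad cb by (simp_all add: bracket_add_left)
  then show False using line[of "a + c" b d] ab notin by simp
qed

end

section \<open>The equality case and the bound\<close>

context finite_dimensional_lie_algebra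
begin

text \<open>Restates the dimension condition in the form that equality in the count produces. If the
  derived subalgebra is a line, each nonzero image is squeezed between a line and that subalgebra.
  Conversely, an image with as many elements as a line equals any line inside it, so
  \<open>brackets_collinear\<close> applies.\<close>

lemma dim_derived_subalgebra_eq_1_iff:
  assumes "\<not> abelian" "finite (UNIV :: 'k set)"
  shows "dim derived_subalgebra = 1 \<longleftrightarrow>
    (\<forall>x. (\<exists>y. bracket x y \<noteq> 0) \<longrightarrow> card (range (bracket x)) = card (UNIV :: 'k set))"
    (is "?lhs \<longleftrightarrow> ?rhs")
proof
  have card_line: "card (span {u}) = card (UNIV :: 'k set)" if "u \<noteq> 0" for u
    using finite_card_span[OF assms(2), of "{u}"] that by simp
  note fin = finite_UNIV[OF assms(2)]
  {
    assume ?lhs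
    then have card: "card derived_subalgebra = card (UNIV :: 'k set)"
      using card_subspace[OF assms(2), of derived_subalgebra]
      by (simp add: derived_subalgebra_def)
    show ?rhs
    proof (intro allI impI, elim exE)
      fix x y assume "bracket x y \<noteq> 0"
      then have "card (UNIV :: 'k set) \<le> card (range (bracket x))"
        using card_mono[OF finite_imageI[OF fin] span_singleton_subset_range_bracket] card_line
        by metis
      moreover have "range (bracket x) \<subseteq> derived_subalgebra"
        unfolding derived_subalgebra_def by (auto intro!: span_base)
      then have "card (range (bracket x)) \<le> card derived_subalgebra"
        by (rule card_mono[OF finite_subset[OF subset_UNIV fin]])
      ultimately show "card (range (bracket x)) = card (UNIV :: 'k set)"
        using card by simp
    qed
  }
  {
    assume rhs: ?rhs
    have line: "bracket x z \<in> span {bracket x y}" if "bracket x y \<noteq> 0" for x y z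
    proof -
      have "span {bracket x y} = range (bracket x)"
        by (rule card_subset_eq[OF finite_imageI[OF fin] span_singleton_subset_range_bracket])
          (use rhs that card_line in auto)
      then show ?thesis by simp
    qed
    obtain a b where ab: "bracket a b \<noteq> 0"
      using assms(1) by (auto simp: abelian_def)
    have "{bracket x y |x y. True} \<subseteq> span {bracket a b}"
      using brackets_collinear[OF line ab] by auto
    then have "derived_subalgebra = span {bracket a b}"
      unfolding derived_subalgebra_def
      by (intro antisym span_minimal span_mono) auto
    then show ?lhs using dim_span_eq_card_independent[of "{bracket a b}"] ab by simp
  }
qed

lemma commutativity_degree_bound:
  assumes "\<not> abelian" "center = {0}" "finite (UNIV :: 'k set)"
  defines "q \<equiv> card (UNIV :: 'k set)" and "n \<equiv> dim UNIV"
  shows "commutativity_degree \<le> (real q ^ n + real q - 1) / real q ^ (n + 1)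
    \<and> (commutativity_degree = (real q ^ n + real q - 1) / real q ^ (n + 1)
         \<longleftrightarrow> dim derived_subalgebra = 1)"
proof -
  note fin = finite_UNIV[OF assms(3)]
  define N where "N = card (UNIV :: 'l set)"
  define c where "c x = card {y. bracket x y = 0}" for x
  define r where "r x = card (range (bracket x))" for x
  have q0: "q > 0" using assms(3) by (simp add: q_def card_gt_0_iff)
  have N: "N = q ^ n"
    unfolding N_def q_def n_def by (rule card_subspace[OF assms(3) subspace_UNIV])
  have cr: "c x * r x = N" for x
    unfolding c_def r_def N_def
    by (rule card_kernel_mult_card_range[where f = "bracket x", OF bracket_add_right fin])
  have nonzero: "(\<exists>y. bracket x y \<noteq> 0) \<longleftrightarrow> x \<noteq> 0" for x
    using assms(2) by (auto simp: center_def)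
  have r_ge: "q \<le> r x" if x: "x \<noteq> 0" for x
  proof -
    obtain y where y: "bracket x y \<noteq> 0" using nonzero[of x] x by blast
    have "card (span {bracket x y}) = q"
      using finite_card_span[OF assms(3), of "{bracket x y}"] y by (simp add: q_def)
    then show ?thesis
      using card_mono[OF finite_imageI[OF fin] span_singleton_subset_range_bracket[of x y]]
      by (simp add: r_def)
  qed
  \<comment> \<open>Positivity allows \<open>c x\<close> to be cancelled from
    \<open>c x * r x = N\<close> in \<open>eq\<close> below.\<close>
  have c0: "c x > 0" for x
    using cr[of x] N q0 by (cases "c x = 0") simp_all
  have le: "q * c x \<le> N" if "x \<noteq> 0" for x
    using mult_le_mono2[OF r_ge[OF that], of "c x"] cr[of x] by (simp add: mult.commute)
  have eq: "q * c x = N \<longleftrightarrow> r x = q" for x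
    using cr[of x] c0[of x] by (auto simp: mult.commute)
  define T where "T = card {(x, y). bracket x y = 0}"
  have "{(x, y). bracket x y = 0} = (SIGMA x:UNIV. {y. bracket x y = 0})" by auto
  then have "T = (\<Sum>x\<in>UNIV. c x)"
    unfolding T_def c_def using fin
    by (simp add: card_SigmaI finite_subset[OF subset_UNIV fin])
  \<comment> \<open>The zero vector commutes with all \<open>N\<close> elements.\<close>
  also have "\<dots> = N + (\<Sum>x\<in>UNIV - {0}. c x)"
    by (subst sum.remove[OF fin, of 0]) (simp_all add: c_def N_def)
  finally have T: "real T = N + (\<Sum>x\<in>UNIV - {0}. real (c x))" by simp
  have N1: "N > 0" using N q0 by simp
  \<comment> \<open>\<open>D\<close> is the total slack in the estimates \<open>le\<close>. Its
    summands are nonnegative, so it vanishes exactly when every estimate is sharp, that is, when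
    every \<open>r x\<close> with \<open>x\<close> nonzero equals \<open>q\<close>.\<close>
  define D where "D = (\<Sum>x\<in>UNIV - {0}. real N - real q * real (c x))"
  have "D = real (card (UNIV - {0 :: 'l})) * real N - real q * (real T - real N)"
    unfolding D_def T by (simp add: sum_subtractf sum_distrib_left)
  also have "real (card (UNIV - {0 :: 'l})) = real N - 1"
    using fin N1 by (simp add: card_Diff_singleton N_def of_nat_diff)
  finally have D: "D = real N * (real N + real q - 1) - real q * real T"
    by (simp add: algebra_simps)
  have diff_nonneg: "real N - real q * real (c x) \<ge> 0" if "x \<in> UNIV - {0}" for x
    using le[of x] that by (simp flip: of_nat_mult)
  have "D \<ge> 0" unfolding D_def by (rule sum_nonneg[OF diff_nonneg])
  have "D = 0 \<longleftrightarrow> (\<forall>x\<in>UNIV - {0}. real N - real q * real (c x) = 0)"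
    unfolding D_def using fin
    by (intro sum_nonneg_eq_0_iff[OF _ diff_nonneg]) simp_all
  also have "\<dots> \<longleftrightarrow> (\<forall>x. x \<noteq> 0 \<longrightarrow> r x = q)"
    by (auto simp flip: eq of_nat_mult)
  also have "\<dots> \<longleftrightarrow> dim derived_subalgebra = 1"
    unfolding dim_derived_subalgebra_eq_1_iff[OF assms(1,3)] nonzero r_def q_def ..
  finally have D0: "D = 0 \<longleftrightarrow> dim derived_subalgebra = 1" .
  \<comment> \<open>Since \<open>q ^ (n + 1)\<close> is \<open>q * N\<close>, the gap is
    \<open>(N + q - 1) / (q * N) - T / N ^ 2\<close>. Over the common denominator
    \<open>q * N ^ 2\<close> its numerator is \<open>D\<close>, so the sign and the vanishing of
    \<open>D\<close> settle both claims.\<close>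
  have "(real q ^ n + real q - 1) / real q ^ (n + 1) - commutativity_degree
      = D / (real q * real N ^ 2)"
    unfolding commutativity_degree_def T_def[symmetric] N_def[symmetric] D
    using q0 N1 by (simp add: N field_simps power2_eq_square)
  moreover have "D / (real q * real N ^ 2) \<ge> 0"
    using \<open>D \<ge> 0\<close> by simp
  moreover have "D / (real q * real N ^ 2) = 0 \<longleftrightarrow> dim derived_subalgebra = 1"
    using D0 q0 N1 by simp
  ultimately show ?thesis by linarith
qed

end

theorem theorem4p1:
  fixes scale :: "'k::{field,finite} \<Rightarrow> 'l::ab_group_add \<Rightarrow> 'l"
    and bracket :: "'l \<Rightarrow> 'l \<Rightarrow> 'l"
    and Basis :: "'l set"
    and q n :: nat
  assumes "finite_dimensional_lie_algebra scale bracket Basis"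
    and "q = card (UNIV :: 'k set)"
    and "n = vector_space.dim scale (UNIV :: 'l set)"
    and "\<not> lie_algebra.abelian bracket"
    and "lie_algebra.center bracket = {0}"
  shows "lie_algebra.commutativity_degree bracket \<le> (real q ^ n + real q - 1) / real q ^ (n + 1)
    \<and> (lie_algebra.commutativity_degree bracket = (real q ^ n + real q - 1) / real q ^ (n + 1)
         \<longleftrightarrow> vector_space.dim scale (lie_algebra.derived_subalgebra scale bracket) = 1)"
  unfolding assms(2,3)
  by (rule finite_dimensional_lie_algebra.commutativity_degree_bound[OF assms(1,4,5) finite])

end
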